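(* A binary function is stable if and only if it has no minor isomorphic to $f_{-1}$.
   Context: A binary function on a finite ground set $E$ is a function $f\colon 2^E\to\mathbb{R}$ with $f(\emptyset)=1$. For $X\subseteq E$, the contraction $f/X\colon 2^{E\setminus X}\to\mathbb{R}$ is $f/X(Y)=f(Y)$. The deletion $f\setminus X\colon 2^{E\setminus X}\to\mathbb{R}$ is $f\setminus X(Y)=\frac{\sum_{Z\subseteq X} f(Y\cup Z)}{\sum_{Z\subseteq X} f(Z)}$, which is well defined exactly when the denominator is nonzero. For disjoint $X,Y\subseteq E$, $f/X\setminus Y$ denotes $(f/X)\setminus Y$. A minor of $f$ is a well-defined binary function of the form $f/X\setminus Y$ for disjoint $X,Y\subseteq E$. The binary function $f$ is stable if $f/X\setminus Y$ is well defined for all disjoint $X,Y\subseteq E$. Two binary functions $f$ on $E$ and $f'$ on $E'$ are isomorphic if there is a bijection $\phi\colon E\to E'$ with $f(X)=f'(\phi(X))$ for all $X\subseteq E$. For $\alpha\in\mathbb{R}$, $f_\alpha$ denotes the binary function on a one-element ground set $E$ with $f_\alpha(E)=\alpha$ (unique up to isomorphism). *)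

theory Defs
  imports Complex_Main "HOL-Library.FuncSet"
begin

text \<open>A real-valued function on the subsets of a ground set. Functions with domain \<open>2\<^sup>E\<close> are
  represented as total functions that are \<open>undefined\<close> outside \<open>Pow E\<close>, so that equality of records
  is equality of the functions represented.\<close>

record 'a set_fun =
  ground :: "'a set"
  val :: "'a set \<Rightarrow> real"

definition binary_function :: "'a set_fun \<Rightarrow> bool" where
  "binary_function f \<longleftrightarrow>
     finite (ground f) \<and> val f \<in> extensional (Pow (ground f)) \<and> val f {} = 1"

definition contract :: "'a set_fun \<Rightarrow> 'a set \<Rightarrow> 'a set_fun" where
  "contract f X = \<lparr>ground = ground f - X, val = (\<lambda>Y \<in> Pow (ground f - X). val f Y)\<rparr>"

definition delete :: "'a set_fun \<Rightarrow> 'a set \<Rightarrow> 'a set_fun" where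
  "delete f X = \<lparr>ground = ground f - X,
     val = (\<lambda>Y \<in> Pow (ground f - X).
              (\<Sum>Z \<in> Pow X. val f (Y \<union> Z)) / (\<Sum>Z \<in> Pow X. val f Z))\<rparr>"

text \<open>Since \<open>x / 0 = 0\<close>, \<open>delete f X\<close> is meaningful only under the following condition.\<close>

definition delete_well_defined :: "'a set_fun \<Rightarrow> 'a set \<Rightarrow> bool" where
  "delete_well_defined f X \<longleftrightarrow> (\<Sum>Z \<in> Pow X. val f Z) \<noteq> 0"

definition minor_of :: "'a set_fun \<Rightarrow> 'a set_fun \<Rightarrow> bool" where
  "minor_of g f \<longleftrightarrow> (\<exists>X Y. X \<subseteq> ground f \<and> Y \<subseteq> ground f \<and> X \<inter> Y = {} \<and>
     delete_well_defined (contract f X) Y \<and> g = delete (contract f X) Y)"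

definition stable_function :: "'a set_fun \<Rightarrow> bool" where
  "stable_function f \<longleftrightarrow> (\<forall>X Y. X \<subseteq> ground f \<longrightarrow> Y \<subseteq> ground f \<longrightarrow> X \<inter> Y = {} \<longrightarrow>
     delete_well_defined (contract f X) Y)"

definition isomorphic :: "'a set_fun \<Rightarrow> 'b set_fun \<Rightarrow> bool" where
  "isomorphic f g \<longleftrightarrow> (\<exists>\<phi>. bij_betw \<phi> (ground f) (ground g) \<and>
     (\<forall>X. X \<subseteq> ground f \<longrightarrow> val f X = val g (\<phi> ` X)))"

definition f_alpha :: "real \<Rightarrow> unit set_fun" where
  "f_alpha \<alpha> = \<lparr>ground = {()}, val = (\<lambda>X. if X = {} then 1 else \<alpha>)\<rparr>"

lemma binary_function_contract:
  "binary_function f \<Longrightarrow> binary_function (contract f X)"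
  by (simp add: binary_function_def contract_def)

lemma binary_function_delete:
  "binary_function f \<Longrightarrow> delete_well_defined f X \<Longrightarrow> binary_function (delete f X)"
  by (simp add: binary_function_def delete_def delete_well_defined_def)

lemma binary_function_f_alpha: "binary_function (f_alpha \<alpha>)"
proof -
  have "Pow {()} = UNIV"
    by auto
  then show ?thesis
    by (simp add: binary_function_def f_alpha_def extensional_def)
qed

lemma isomorphic_f_alpha_iff:
  assumes "binary_function g"
  shows "isomorphic g (f_alpha \<alpha>) \<longleftrightarrow> card (ground g) = 1 \<and> val g (ground g) = \<alpha>"
proof
  assume "isomorphic g (f_alpha \<alpha>)"
  then obtain \<phi> where bij: "bij_betw \<phi> (ground g) {()}"
    and val: "\<And>X. X \<subseteq> ground g \<Longrightarrow> val g X = val (f_alpha \<alpha>) (\<phi> ` X)"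
    by (auto simp: isomorphic_def f_alpha_def)
  have "card (ground g) = 1"
    using bij_betw_same_card[OF bij] by simp
  moreover from this have "ground g \<noteq> {}"
    by auto
  ultimately show "card (ground g) = 1 \<and> val g (ground g) = \<alpha>"
    using val[of "ground g"] by (simp add: f_alpha_def)
next
  assume g: "card (ground g) = 1 \<and> val g (ground g) = \<alpha>"
  then obtain e where e: "ground g = {e}"
    by (auto simp: card_1_singleton_iff)
  have "bij_betw (\<lambda>_. ()) (ground g) (ground (f_alpha \<alpha>))"
    by (simp add: e f_alpha_def bij_betw_def)
  moreover have "val g X = val (f_alpha \<alpha>) ((\<lambda>_. ()) ` X)" if "X \<subseteq> ground g" for X
    using that g assms by (auto simp: e f_alpha_def binary_function_def subset_singleton_iff)
  ultimately show "isomorphic g (f_alpha \<alpha>)"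
    unfolding isomorphic_def by blast
qed

end

theory Submission
  imports Defs
begin

text \<open>Let \<open>S Y\<close> be the sum of \<open>f\<close> over all subsets of \<open>Y\<close>. Contraction restricts \<open>S\<close>, and deleting
  \<open>Y\<close> turns it into \<open>W \<mapsto> S (W \<union> Y) / S Y\<close>. Hence \<open>f\<close> is stable iff \<open>S\<close> vanishes nowhere, and
  the minors isomorphic to \<open>f\<^sub>\<alpha>\<close> correspond to the pairs \<open>Y\<close>, \<open>e \<notin> Y\<close> with \<open>S Y \<noteq> 0\<close> and
  \<open>S (Y \<union> {e}) = (1 + \<alpha>) S Y\<close>. For \<open>\<alpha> = -1\<close> such a pair is a step at which \<open>S\<close> drops to \<open>0\<close>; since
  \<open>S {} = 1\<close>, a zero of \<open>S\<close> exists iff such a step does.\<close>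

definition subset_sum :: "('a set \<Rightarrow> 'b::comm_monoid_add) \<Rightarrow> 'a set \<Rightarrow> 'b" where
  "subset_sum F Y = (\<Sum>Z \<in> Pow Y. F Z)"

lemma subset_sum_empty [simp]: "subset_sum F {} = F {}"
  by (simp add: subset_sum_def)

lemma subset_sum_singleton: "subset_sum F {e} = F {} + F {e}"
  by (simp add: subset_sum_def Pow_insert add.commute)

lemma subset_sum_cong: "(\<And>Z. Z \<subseteq> Y \<Longrightarrow> F Z = G Z) \<Longrightarrow> subset_sum F Y = subset_sum G Y"
  by (simp add: subset_sum_def)

lemma subset_sum_Un_disjoint:
  assumes "W \<inter> Y = {}"
  shows "subset_sum F (W \<union> Y) = subset_sum (\<lambda>V. subset_sum (\<lambda>Z. F (V \<union> Z)) Y) W"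
proof -
  have "bij_betw (\<lambda>(V, Z). V \<union> Z) (Pow W \<times> Pow Y) (Pow (W \<union> Y))"
    by (rule bij_betw_byWitness[where f' = "\<lambda>U. (U \<inter> W, U \<inter> Y)"]) (use assms in auto)
  then have "subset_sum F (W \<union> Y) = (\<Sum>(V, Z) \<in> Pow W \<times> Pow Y. F (V \<union> Z))"
    unfolding subset_sum_def by (simp add: sum.reindex_bij_betw[symmetric] case_prod_beta)
  then show ?thesis
    by (simp add: subset_sum_def sum.cartesian_product)
qed

lemma subset_sum_contract:
  "W \<subseteq> ground f - X \<Longrightarrow> subset_sum (val (contract f X)) W = subset_sum (val f) W"
  by (rule subset_sum_cong) (auto simp: contract_def)

lemma subset_sum_delete:
  assumes "W \<subseteq> ground f - Y"
  shows "subset_sum (val (delete f Y)) W = subset_sum (val f) (W \<union> Y) / subset_sum (val f) Y"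
proof -
  have "subset_sum (val (delete f Y)) W =
      subset_sum (\<lambda>V. subset_sum (\<lambda>Z. val f (V \<union> Z)) Y / subset_sum (val f) Y) W"
    by (rule subset_sum_cong) (use assms in \<open>auto simp: delete_def subset_sum_def\<close>)
  also have "\<dots> = subset_sum (\<lambda>V. subset_sum (\<lambda>Z. val f (V \<union> Z)) Y) W / subset_sum (val f) Y"
    by (simp add: subset_sum_def sum_divide_distrib)
  also have "\<dots> = subset_sum (val f) (W \<union> Y) / subset_sum (val f) Y"
    using assms by (subst subset_sum_Un_disjoint) auto
  finally show ?thesis .
qed

lemma ground_delete_contract: "ground (delete (contract f X) Y) = ground f - X - Y"
  by (simp add: delete_def contract_def)

lemma delete_well_defined_contract_iff:
  assumes "Y \<subseteq> ground f - X"
  shows "delete_well_defined (contract f X) Y \<longleftrightarrow> subset_sum (val f) Y \<noteq> 0"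
  using subset_sum_contract[OF assms] by (simp add: delete_well_defined_def subset_sum_def)

lemma stable_function_iff_subset_sum_nonzero:
  "stable_function f \<longleftrightarrow> (\<forall>Y \<subseteq> ground f. subset_sum (val f) Y \<noteq> 0)"
proof
  assume "stable_function f"
  then have "delete_well_defined (contract f {}) Y" if "Y \<subseteq> ground f" for Y
    using that by (simp add: stable_function_def)
  then show "\<forall>Y \<subseteq> ground f. subset_sum (val f) Y \<noteq> 0"
    by (simp add: delete_well_defined_contract_iff)
next
  assume "\<forall>Y \<subseteq> ground f. subset_sum (val f) Y \<noteq> 0"
  moreover have "Y \<subseteq> ground f - X" if "Y \<subseteq> ground f" "X \<inter> Y = {}" for X Y
    using that by blast
  ultimately show "stable_function f"
    by (simp add: stable_function_def delete_well_defined_contract_iff)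
qed

lemma isomorphic_f_alpha_iff_subset_sum:
  assumes "binary_function g"
  shows "isomorphic g (f_alpha \<alpha>) \<longleftrightarrow>
    (\<exists>e. ground g = {e} \<and> subset_sum (val g) {e} = 1 + \<alpha>)"
proof -
  have "val g {} = 1"
    using assms by (simp add: binary_function_def)
  then show ?thesis
    by (auto simp: isomorphic_f_alpha_iff[OF assms] card_1_singleton_iff subset_sum_singleton)
qed

lemma isomorphic_delete_contract_f_alpha_iff:
  assumes "binary_function f" "Y \<subseteq> ground f - X" "subset_sum (val f) Y \<noteq> 0"
  shows "isomorphic (delete (contract f X) Y) (f_alpha \<alpha>) \<longleftrightarrow>
    (\<exists>e. ground f - X - Y = {e} \<and>
       subset_sum (val f) (insert e Y) = (1 + \<alpha>) * subset_sum (val f) Y)"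
proof -
  have "binary_function (delete (contract f X) Y)"
    using assms
    by (simp add: binary_function_delete binary_function_contract delete_well_defined_contract_iff)
  moreover have "subset_sum (val (delete (contract f X) Y)) {e} =
      subset_sum (val f) (insert e Y) / subset_sum (val f) Y"
    if e: "ground f - X - Y = {e}" for e
  proof -
    have "{e} \<subseteq> ground (contract f X) - Y" "insert e Y \<subseteq> ground f - X"
      using e assms(2) by (auto simp: contract_def)
    then show ?thesis
      using assms(2) by (simp add: subset_sum_delete subset_sum_contract)
  qed
  ultimately show ?thesis
    using assms(3)
    by (auto simp: isomorphic_f_alpha_iff_subset_sum ground_delete_contract divide_eq_eq)
qed

lemma has_minor_isomorphic_f_alpha_iff:
  assumes "binary_function f"
  shows "(\<exists>g. minor_of g f \<and> isomorphic g (f_alpha \<alpha>)) \<longleftrightarrow>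
    (\<exists>Y e. insert e Y \<subseteq> ground f \<and> e \<notin> Y \<and> subset_sum (val f) Y \<noteq> 0 \<and>
       subset_sum (val f) (insert e Y) = (1 + \<alpha>) * subset_sum (val f) Y)"
    (is "?has_minor \<longleftrightarrow> ?has_step")
proof
  assume ?has_minor
  then obtain X Y where "Y \<subseteq> ground f" "X \<inter> Y = {}"
    and well_defined: "delete_well_defined (contract f X) Y"
    and iso: "isomorphic (delete (contract f X) Y) (f_alpha \<alpha>)"
    by (auto simp: minor_of_def)
  then have Y: "Y \<subseteq> ground f - X"
    by blast
  with well_defined have nonzero: "subset_sum (val f) Y \<noteq> 0"
    by (simp add: delete_well_defined_contract_iff)
  with iso obtain e where "ground f - X - Y = {e}"
    and "subset_sum (val f) (insert e Y) = (1 + \<alpha>) * subset_sum (val f) Y"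
    using isomorphic_delete_contract_f_alpha_iff[OF assms Y] by blast
  with Y nonzero show ?has_step
    by blast
next
  assume ?has_step
  then obtain Y e where step: "insert e Y \<subseteq> ground f" "e \<notin> Y"
    and nonzero: "subset_sum (val f) Y \<noteq> 0"
    and sum_insert: "subset_sum (val f) (insert e Y) = (1 + \<alpha>) * subset_sum (val f) Y"
    by blast
  define X where "X = ground f - insert e Y"
  have Y: "Y \<subseteq> ground f - X" and e: "ground f - X - Y = {e}"
    using step by (auto simp: X_def)
  have "isomorphic (delete (contract f X) Y) (f_alpha \<alpha>)"
    using isomorphic_delete_contract_f_alpha_iff[OF assms Y nonzero] e sum_insert by blast
  moreover have "delete_well_defined (contract f X) Y"
    using Y nonzero by (simp add: delete_well_defined_contract_iff)
  moreover have "X \<subseteq> ground f" "Y \<subseteq> ground f" "X \<inter> Y = {}"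
    using step by (auto simp: X_def)
  ultimately show ?has_minor
    unfolding minor_of_def by blast
qed

theorem theorem2:
  fixes f :: "'a set_fun"
  assumes "binary_function f"
  shows "stable_function f \<longleftrightarrow> \<not> (\<exists>g. minor_of g f \<and> isomorphic g (f_alpha (-1)))"
proof
  assume "stable_function f"
  then show "\<not> (\<exists>g. minor_of g f \<and> isomorphic g (f_alpha (-1)))"
    by (auto simp: stable_function_iff_subset_sum_nonzero has_minor_isomorphic_f_alpha_iff[OF assms])
next
  assume "\<not> (\<exists>g. minor_of g f \<and> isomorphic g (f_alpha (-1)))"
  then have nonzero_insert: "subset_sum (val f) (insert e Y) \<noteq> 0"
    if "insert e Y \<subseteq> ground f" "e \<notin> Y" "subset_sum (val f) Y \<noteq> 0" for e Y
    using that by (auto simp: has_minor_isomorphic_f_alpha_iff[OF assms])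
  have "subset_sum (val f) W \<noteq> 0" if "W \<subseteq> ground f" for W
  proof -
    have "finite W"
      using that assms finite_subset by (auto simp: binary_function_def)
    then show ?thesis
      using that
    proof (induction rule: finite_subset_induct')
      case empty
      show ?case
        using assms by (simp add: binary_function_def)
    qed (simp add: nonzero_insert)
  qed
  then show "stable_function f"
    by (simp add: stable_function_iff_subset_sum_nonzero)
qed

end
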